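(* Let $G_1,\ldots,G_n$ be nondeterministic automata, where $G_i$ has set of secret states $Q_i^S$, and consider the composed system $G_1\|\cdots\|G_n$ with interaction $\|_\lor$, i.e. with set of secret states $Q^S=Q\setminus(Q_1^{NS}\times\cdots\times Q_n^{NS})$, $Q_i^{NS}=Q_i\setminus Q_i^S$. Let $\sim$ be an opaque observation equivalence on $G_1$ and $\tilde G_1$ the quotient automaton of $G_1$ modulo $\sim$. Then $G_1\|\cdots\|G_n$ is infinite-step opaque if and only if $\tilde G_1\|G_2\|\cdots\|G_n$ is infinite-step opaque (with secret states defined in the same $\|_\lor$ manner).
   Context: An automaton is $G=\langle\Sigma_\tau,Q,\to,Q^\circ\rangle$ with finite set $\Sigma$ of observable events, a special unobservable event $\tau\notin\Sigma$, $\Sigma_\tau=\Sigma\cup\{\tau\}$, finite states $Q$, transitions $\to\subseteq Q\times\Sigma_\tau\times Q$, initial states $Q^\circ$; it carries secret states $Q^S\subseteq Q$ and $Q^{NS}=Q\setminus Q^S$. For $s\in\Sigma^*$, $p\stackrel{s}{\Rightarrow}q$ means there is $t\in\Sigma_\tau^*$ which becomes $s$ after deleting all $\tau$'s and $p\stackrel{t}{\to}q$; $p\stackrel{s}{\Rightarrow}$ means $p\stackrel{s}{\Rightarrow}q$ for some $q$; $L(G,q)=\{s\in\Sigma^*:q\stackrel{s}{\Rightarrow}\}$. Synchronous composition: states are tuples, initial states products of initial states; an event in $\Sigma$ shared by components is executed jointly by all components having it in their alphabet; other events (including $\tau$, never shared) are executed by a single component while the others stay put. Infinite-step opacity: $G$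 is infinite-step opaque w.r.t. $Q^S$ iff for every $q^\circ\in Q^\circ$ and all $s,t\in\Sigma^*$ with $st\in L(G,q^\circ)$ and $q^\circ\stackrel{s}{\Rightarrow}Q^S$, there exist $q'^\circ\in Q^\circ$ and $y\in Q^{NS}$ with $q'^\circ\stackrel{s}{\Rightarrow}y$ and $y\stackrel{t}{\Rightarrow}$. Opaque observation equivalence: an equivalence relation $\sim$ on $Q$ such that whenever $x_1\sim x_2$: (i) if $x_1\stackrel{s}{\Rightarrow}y_1$ for some $s\in\Sigma^*$, then there is $y_2$ with $x_2\stackrel{s}{\Rightarrow}y_2$ and $y_1\sim y_2$; (ii) $x_1\in Q^S$ iff $x_2\in Q^S$. Quotient automaton modulo $\sim$: states are the classes $[x]$, $([x],\sigma,[y])$ is a transition iff $x'\stackrel{\sigma}{\to}y'$ for some $x'\in[x]$, $y'\in[y]$, initial states $\{[x^\circ]:x^\circ\in Q^\circ\}$; a class $[x]$ is secret iff $x\in Q^S$. *)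

theory Defs
  imports Main
begin

text \<open>
  Events are of type \<^typ>\<open>'e option\<close>: \<open>Some \<sigma>\<close> is the observable event \<open>\<sigma>\<close> and \<open>None\<close> is the
  unobservable event \<open>\<tau>\<close>. The field \<open>alphabet\<close> is the set \<open>\<Sigma>\<close> of observable events.
\<close>

record ('q, 'e) aut =
  alphabet :: "'e set"
  states :: "'q set"
  transitions :: "('q \<times> 'e option \<times> 'q) set"
  initial :: "'q set"
  secret :: "'q set"

definition events_tau :: "('q, 'e) aut \<Rightarrow> 'e option set" where
  "events_tau G = insert None (Some ` alphabet G)"

definition automaton :: "('q, 'e) aut \<Rightarrow> bool" where
  "automaton G \<longleftrightarrow>
     finite (alphabet G) \<and> finite (states G) \<and>
     transitions G \<subseteq> states G \<times> events_tau G \<times> states G \<and>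
     initial G \<subseteq> states G \<and> secret G \<subseteq> states G"

definition nonsecret :: "('q, 'e) aut \<Rightarrow> 'q set" where
  "nonsecret G = states G - secret G"

fun run :: "('q, 'e) aut \<Rightarrow> 'q \<Rightarrow> 'e option list \<Rightarrow> 'q \<Rightarrow> bool" where
  "run G p [] q \<longleftrightarrow> p \<in> states G \<and> p = q"
| "run G p (a # t) q \<longleftrightarrow> (\<exists>r. (p, a, r) \<in> transitions G \<and> run G r t q)"

text \<open>\<open>List.map_filter id\<close> deletes every \<open>\<tau>\<close> and strips the constructor \<open>Some\<close>.\<close>

definition weak_run :: "('q, 'e) aut \<Rightarrow> 'q \<Rightarrow> 'e list \<Rightarrow> 'q \<Rightarrow> bool" where
  "weak_run G p s q \<longleftrightarrow>
     s \<in> lists (alphabet G) \<and>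
     (\<exists>t \<in> lists (events_tau G). List.map_filter id t = s \<and> run G p t q)"

definition lang :: "('q, 'e) aut \<Rightarrow> 'q \<Rightarrow> 'e list set" where
  "lang G q = {s \<in> lists (alphabet G). \<exists>q'. weak_run G q s q'}"

definition infinite_step_opaque :: "('q, 'e) aut \<Rightarrow> bool" where
  "infinite_step_opaque G \<longleftrightarrow>
     (\<forall>q0 \<in> initial G. \<forall>s \<in> lists (alphabet G). \<forall>t \<in> lists (alphabet G).
        s @ t \<in> lang G q0 \<and> (\<exists>x \<in> secret G. weak_run G q0 s x) \<longrightarrow>
        (\<exists>q0' \<in> initial G. \<exists>y \<in> nonsecret G. weak_run G q0' s y \<and> (\<exists>z. weak_run G y t z)))"

definition opaque_observation_equivalence :: "('q, 'e) aut \<Rightarrow> ('q \<times> 'q) set \<Rightarrow> bool" where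
  "opaque_observation_equivalence G R \<longleftrightarrow>
     equiv (states G) R \<and>
     (\<forall>x1 x2. (x1, x2) \<in> R \<longrightarrow>
        (\<forall>s \<in> lists (alphabet G). \<forall>y1. weak_run G x1 s y1 \<longrightarrow>
           (\<exists>y2. weak_run G x2 s y2 \<and> (y1, y2) \<in> R)) \<and>
        (x1 \<in> secret G \<longleftrightarrow> x2 \<in> secret G))"

definition quotient_aut :: "('q, 'e) aut \<Rightarrow> ('q \<times> 'q) set \<Rightarrow> ('q set, 'e) aut" where
  "quotient_aut G R =
     \<lparr> alphabet = alphabet G,
       states = states G // R,
       transitions = {(X, a, Y). X \<in> states G // R \<and> Y \<in> states G // R \<and>
                        (\<exists>x \<in> X. \<exists>y \<in> Y. (x, a, y) \<in> transitions G)},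
       initial = {R `` {x} | x. x \<in> initial G},
       secret = {R `` {x} | x. x \<in> secret G} \<rparr>"

text \<open>
  How one component takes part in an observable event \<open>\<sigma>\<close> of the composition: it executes \<open>\<sigma>\<close>
  if \<open>\<sigma>\<close> is in its alphabet and stays put otherwise.
\<close>

definition takes_part :: "('q, 'e) aut \<Rightarrow> 'e \<Rightarrow> 'q \<Rightarrow> 'q \<Rightarrow> bool" where
  "takes_part G \<sigma> x y \<longleftrightarrow>
     (if \<sigma> \<in> alphabet G then (x, Some \<sigma>, y) \<in> transitions G else y = x)"

text \<open>
  The set of tuples \<open>A\<^sub>1 \<times> A\<^sub>2 \<times> \<dots> \<times> A\<^sub>n\<close>, where \<open>A\<^sub>i = f G\<^sub>i\<close> for \<open>i \<ge> 2\<close>. The tuple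
  \<open>(x\<^sub>1, \<dots>, x\<^sub>n)\<close> is represented as \<open>(x\<^sub>1, [x\<^sub>2, \<dots>, x\<^sub>n])\<close>, so that the type of
  the first component may differ from that of the others, as it does after passing to a quotient.
\<close>

definition tuples :: "'p set \<Rightarrow> ('a \<Rightarrow> 'q set) \<Rightarrow> 'a list \<Rightarrow> ('p \<times> 'q list) set" where
  "tuples A f Gs = {(x, xs). x \<in> A \<and> list_all2 (\<lambda>y G. y \<in> f G) xs Gs}"

text \<open>
  Synchronous composition of \<open>G\<^sub>1\<close> and \<open>Gs = [G\<^sub>2, \<dots>, G\<^sub>n]\<close>, where a tuple is secret
  iff at least one of its components is.
\<close>

definition sync_or ::
  "('p, 'e) aut \<Rightarrow> ('q, 'e) aut list \<Rightarrow> ('p \<times> 'q list, 'e) aut" where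
  "sync_or G1 Gs =
     (let \<Sigma> = alphabet G1 \<union> (\<Union>G \<in> set Gs. alphabet G);
          Q = tuples (states G1) states Gs
      in \<lparr> alphabet = \<Sigma>,
           states = Q,
           transitions =
             {((x, xs), Some \<sigma>, (y, ys)) | x xs \<sigma> y ys.
                (x, xs) \<in> Q \<and> (y, ys) \<in> Q \<and> \<sigma> \<in> \<Sigma> \<and> takes_part G1 \<sigma> x y \<and>
                (\<forall>i < length Gs. takes_part (Gs ! i) \<sigma> (xs ! i) (ys ! i))} \<union>
             {((x, xs), None, (y, xs)) | x xs y.
                (x, xs) \<in> Q \<and> (y, xs) \<in> Q \<and> (x, None, y) \<in> transitions G1} \<union>
             {((x, xs), None, (x, xs[i := z])) | x xs i z.
                (x, xs) \<in> Q \<and> (x, xs[i := z]) \<in> Q \<and> i < length Gs \<and>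
                (xs ! i, None, z) \<in> transitions (Gs ! i)},
           initial = tuples (initial G1) initial Gs,
           secret = Q - tuples (nonsecret G1) nonsecret Gs \<rparr>)"

end

theory Submission
  imports Defs
begin

text \<open>
  Infinite-step opacity is invariant under weak bisimulations that match initial states and secret
  states. The relation between \<open>(x, xs)\<close> and \<open>([x], xs)\<close> is such a bisimulation: one step
  of the first component of the quotient system is answered by a weak run of \<open>G\<^sub>1\<close>, whose
  silent steps can be performed in the composition while the other components stay put.
\<close>

section \<open>Weak simulations and transfer of opacity\<close>

text \<open>The word \<open>List.map_filter id [a]\<close> is empty for tau and
  \<open>[\<sigma>]\<close> for \<open>Some \<sigma>\<close>, so one clause covers silent and
  observable steps. The inclusion in the state sets matters because an empty run exists only at a
  state.\<close>

definition weak_simulation ::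
  "('p, 'e) aut \<Rightarrow> ('q, 'e) aut \<Rightarrow> ('p \<times> 'q) set \<Rightarrow> bool" where
  "weak_simulation A B S \<longleftrightarrow>
     S \<subseteq> states A \<times> states B \<and>
     (\<forall>p q a p'. (p, q) \<in> S \<and> (p, a, p') \<in> transitions A \<longrightarrow>
        (\<exists>q'. weak_run B q (List.map_filter id [a]) q' \<and> (p', q') \<in> S))"

lemma map_filter_append:
  "List.map_filter f (xs @ ys) = List.map_filter f xs @ List.map_filter f ys"
  by (simp add: List.map_filter_def)

lemma run_append: "run G p s q \<Longrightarrow> run G q t r \<Longrightarrow> run G p (s @ t) r"
  by (induction s arbitrary: p) auto

lemma weak_run_append: "weak_run G p s q \<Longrightarrow> weak_run G q t r \<Longrightarrow> weak_run G p (s @ t) r"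
  unfolding weak_run_def
  by (metis append_in_lists_conv map_filter_append run_append)

lemma weak_run_Nil: "p \<in> states G \<Longrightarrow> weak_run G p [] p"
  unfolding weak_run_def by (auto intro!: bexI[of _ "[]"] simp: List.map_filter_def)

lemma weak_run_step:
  assumes "(p, a, q) \<in> transitions G" and "a \<in> events_tau G" and "q \<in> states G"
  shows "weak_run G p (List.map_filter id [a]) q"
  unfolding weak_run_def
  using assms by (auto intro!: bexI[of _ "[a]"] simp: List.map_filter_def events_tau_def)

text \<open>Induction on the event list: the answers to single steps are concatenated with
  \<open>weak_run_append\<close>, and the empty run is answered by staying at
  \<open>q\<close>.\<close>

lemma weak_simulation_run:
  assumes "weak_simulation A B S" and "run A p t p'" and "(p, q) \<in> S"
  shows "\<exists>q'. weak_run B q (List.map_filter id t) q' \<and> (p', q') \<in> S"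
  using assms(2,3)
proof (induction t arbitrary: p q)
  case Nil
  then show ?case
    using assms(1) weak_run_Nil[of q B] by (auto simp: weak_simulation_def List.map_filter_def)
next
  case (Cons a t)
  then obtain r where r: "(p, a, r) \<in> transitions A" "run A r t p'"
    by auto
  then obtain u where u: "weak_run B q (List.map_filter id [a]) u" "(r, u) \<in> S"
    using assms(1) Cons.prems unfolding weak_simulation_def by blast
  obtain q' where "weak_run B u (List.map_filter id t) q'" "(p', q') \<in> S"
    using Cons.IH r u by blast
  then show ?case
    using weak_run_append[OF u(1)] map_filter_append[of id "[a]" t] by (metis append_Cons append_Nil)
qed

lemma weak_simulation_weak_run:
  assumes "weak_simulation A B S" and "weak_run A p s p'" and "(p, q) \<in> S"
  shows "\<exists>q'. weak_run B q s q' \<and> (p', q') \<in> S"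
  using assms(2) weak_simulation_run[OF assms(1) _ assms(3)] unfolding weak_run_def by blast

text \<open>A secret-revealing situation of \<open>B\<close> is pulled back to \<open>A\<close>
  along the converse of \<open>S\<close>, opacity of \<open>A\<close> supplies a nonsecret
  explanation there, and this explanation is pushed forward to \<open>B\<close> along
  \<open>S\<close>. One implication suffices, since the hypotheses are symmetric under exchanging
  \<open>A\<close> and \<open>B\<close>.\<close>

lemma infinite_step_opaque_bisimilar:
  assumes alph: "alphabet A = alphabet B"
    and AB: "weak_simulation A B S" and BA: "weak_simulation B A (S\<inverse>)"
    and sec: "\<And>p q. (p, q) \<in> S \<Longrightarrow> p \<in> secret A \<longleftrightarrow> q \<in> secret B"
    and init_AB: "\<And>p. p \<in> initial A \<Longrightarrow> \<exists>q \<in> initial B. (p, q) \<in> S"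
    and init_BA: "\<And>q. q \<in> initial B \<Longrightarrow> \<exists>p \<in> initial A. (p, q) \<in> S"
    and op: "infinite_step_opaque A"
  shows "infinite_step_opaque B"
  unfolding infinite_step_opaque_def
proof (intro ballI impI, elim conjE bexE)
  fix q0 s t x
  assume q0: "q0 \<in> initial B" and s: "s \<in> lists (alphabet B)" and t: "t \<in> lists (alphabet B)"
    and st: "s @ t \<in> lang B q0" and x: "x \<in> secret B" "weak_run B q0 s x"
  obtain p0 where p0: "p0 \<in> initial A" "(p0, q0) \<in> S"
    using init_BA q0 by blast
  obtain z where "weak_run B q0 (s @ t) z"
    using st by (auto simp: lang_def)
  then have "s @ t \<in> lang A p0"
    using weak_simulation_weak_run[OF BA, of q0 "s @ t" z p0] p0 s t alph by (auto simp: lang_def)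
  moreover obtain x' where "weak_run A p0 s x'" "(x', x) \<in> S"
    using weak_simulation_weak_run[OF BA x(2), of p0] p0 by auto
  ultimately obtain p1 y z' where p1: "p1 \<in> initial A" "y \<in> nonsecret A"
      "weak_run A p1 s y" "weak_run A y t z'"
    using op p0 s t sec x(1) alph unfolding infinite_step_opaque_def by metis
  obtain q1 where q1: "q1 \<in> initial B" "(p1, q1) \<in> S"
    using init_AB p1 by blast
  obtain w where w: "weak_run B q1 s w" "(y, w) \<in> S"
    using weak_simulation_weak_run[OF AB p1(3) q1(2)] by blast
  \<comment> \<open>Being nonsecret also requires being a state; this comes from the inclusion of
    \<open>S\<close> in the product of the state sets.\<close>
  then have "w \<in> nonsecret B"
    using p1(2) sec AB unfolding nonsecret_def weak_simulation_def by blast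
  moreover obtain z'' where "weak_run B w t z''"
    using weak_simulation_weak_run[OF AB p1(4) w(2)] by blast
  ultimately show "\<exists>q0'\<in>initial B. \<exists>y\<in>nonsecret B. weak_run B q0' s y \<and> (\<exists>z. weak_run B y t z)"
    using q1 w by blast
qed

section \<open>Transitions and lifted runs of the composition\<close>

lemma sync_or_simps:
  "alphabet (sync_or G Gs) = alphabet G \<union> (\<Union>G \<in> set Gs. alphabet G)"
  "states (sync_or G Gs) = tuples (states G) states Gs"
  "initial (sync_or G Gs) = tuples (initial G) initial Gs"
  "secret (sync_or G Gs) = tuples (states G) states Gs - tuples (nonsecret G) nonsecret Gs"
  by (simp_all add: sync_or_def Let_def)

lemma sync_or_transition_Some:
  "((x, xs), Some \<sigma>, (y, ys)) \<in> transitions (sync_or G Gs) \<longleftrightarrow>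
     (x, xs) \<in> states (sync_or G Gs) \<and> (y, ys) \<in> states (sync_or G Gs) \<and>
     \<sigma> \<in> alphabet (sync_or G Gs) \<and> takes_part G \<sigma> x y \<and>
     (\<forall>i < length Gs. takes_part (Gs ! i) \<sigma> (xs ! i) (ys ! i))"
  by (auto simp: sync_or_def Let_def)

lemma sync_or_transition_None:
  "((x, xs), None, (y, ys)) \<in> transitions (sync_or G Gs) \<longleftrightarrow>
     (x, xs) \<in> states (sync_or G Gs) \<and> (y, ys) \<in> states (sync_or G Gs) \<and>
     ((x, None, y) \<in> transitions G \<and> ys = xs \<or>
      y = x \<and> (\<exists>i z. ys = xs[i := z] \<and> i < length Gs \<and> (xs ! i, None, z) \<in> transitions (Gs ! i)))"
  by (auto simp: sync_or_def Let_def)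

lemma sync_or_transition_closed:
  assumes "(u, a, v) \<in> transitions (sync_or G Gs)"
  shows "a \<in> events_tau (sync_or G Gs)" "v \<in> states (sync_or G Gs)"
  using assms by (auto simp: sync_or_def Let_def events_tau_def)

lemma weak_run_sync_or_step:
  "(u, a, v) \<in> transitions (sync_or G Gs) \<Longrightarrow>
     weak_run (sync_or G Gs) u (List.map_filter id [a]) v"
  by (meson sync_or_transition_closed weak_run_step)

text \<open>The same list \<open>t\<close> works in the composition: it contains only tau, which is
  never shared, so the first component moves alone.\<close>

lemma run_sync_or_silent:
  assumes "transitions G \<subseteq> states G \<times> events_tau G \<times> states G"
    and "run G x t y" and "List.map_filter id t = []" and "(x, xs) \<in> states (sync_or G Gs)"
  shows "run (sync_or G Gs) (x, xs) t (y, xs)"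
  using assms(2-4)
proof (induction t arbitrary: x)
  case Nil
  then show ?case by simp
next
  case (Cons a t)
  then obtain r where r: "(x, a, r) \<in> transitions G" "run G r t y"
    by auto
  have a: "a = None" "List.map_filter id t = []"
    using Cons.prems(2) by (auto simp: List.map_filter_def split: if_splits)
  have "(r, xs) \<in> states (sync_or G Gs)"
    using r assms(1) Cons.prems(3) by (auto simp: sync_or_simps tuples_def)
  then show ?case
    using Cons r a by (auto simp: sync_or_transition_None intro!: exI[of _ r] exI[of _ xs])
qed

text \<open>The list \<open>t\<close> is a single \<open>\<sigma>\<close> with taus around it. The
  other components wait at \<open>xs\<close> before \<open>\<sigma>\<close>, move to
  \<open>ys\<close> jointly with it, and wait at \<open>ys\<close> afterwards. The induction covers
  the taus before \<open>\<sigma>\<close>; \<open>run_sync_or_silent\<close> covers those after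
  it.\<close>

lemma run_sync_or_observable:
  assumes tr: "transitions G \<subseteq> states G \<times> events_tau G \<times> states G"
    and \<sigma>: "\<sigma> \<in> alphabet G"
    and xs: "list_all2 (\<lambda>y G. y \<in> states G) xs Gs" and ys: "list_all2 (\<lambda>y G. y \<in> states G) ys Gs"
    and part: "\<forall>i < length Gs. takes_part (Gs ! i) \<sigma> (xs ! i) (ys ! i)"
    and "run G x t y" and "List.map_filter id t = [\<sigma>]"
  shows "run (sync_or G Gs) (x, xs) t (y, ys)"
  using assms(6-)
proof (induction t arbitrary: x)
  case Nil
  then show ?case by (simp add: List.map_filter_def)
next
  case (Cons a t)
  then obtain r where r: "(x, a, r) \<in> transitions G" "run G r t y"
    by auto
  have states: "x \<in> states G" "r \<in> states G"
    using r tr by auto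
  show ?case
  proof (cases a)
    case None
    then have "run (sync_or G Gs) (r, xs) t (y, ys)"
      using Cons r by (simp add: List.map_filter_def)
    moreover have "((x, xs), a, (r, xs)) \<in> transitions (sync_or G Gs)"
      using None r states xs by (auto simp: sync_or_transition_None sync_or_simps tuples_def)
    ultimately show ?thesis by auto
  next
    case (Some \<sigma>')
    then have "\<sigma>' = \<sigma>" and silent: "List.map_filter id t = []"
      using Cons.prems(2) by (auto simp: List.map_filter_def)
    then have "((x, xs), a, (r, ys)) \<in> transitions (sync_or G Gs)"
      using Some r states xs ys part \<sigma>
      by (auto simp: sync_or_transition_Some sync_or_simps tuples_def takes_part_def)
    moreover have "run (sync_or G Gs) (r, ys) t (y, ys)"
      using run_sync_or_silent[OF tr r(2) silent] states ys
      by (auto simp: sync_or_simps tuples_def)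
    ultimately show ?thesis by auto
  qed
qed

section \<open>Transitions of the quotient automaton\<close>

lemma quotient_aut_simps:
  "alphabet (quotient_aut G R) = alphabet G"
  "states (quotient_aut G R) = states G // R"
  "initial (quotient_aut G R) = {R `` {x} | x. x \<in> initial G}"
  "secret (quotient_aut G R) = {R `` {x} | x. x \<in> secret G}"
  "(X, a, Y) \<in> transitions (quotient_aut G R) \<longleftrightarrow>
     X \<in> states G // R \<and> Y \<in> states G // R \<and> (\<exists>x \<in> X. \<exists>y \<in> Y. (x, a, y) \<in> transitions G)"
  by (simp_all add: quotient_aut_def)

text \<open>The underlying transition may start at another member \<open>x'\<close> of the class.
  Read as a weak run from \<open>x'\<close>, it is carried over to \<open>x\<close> by the
  equivalence, possibly gaining silent steps and ending in another member of
  \<open>Y\<close>.\<close>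

lemma quotient_transition_weak_run:
  assumes "automaton G" and "opaque_observation_equivalence G R"
    and "(R `` {x}, a, Y) \<in> transitions (quotient_aut G R)"
  shows "\<exists>y. Y = R `` {y} \<and> y \<in> states G \<and> weak_run G x (List.map_filter id [a]) y"
proof -
  have eq: "equiv (states G) R"
    using assms(2) by (simp add: opaque_observation_equivalence_def)
  obtain x' y' where xy: "(x, x') \<in> R" "y' \<in> Y" "(x', a, y') \<in> transitions G"
      and Y: "Y \<in> states G // R"
    using assms(3) by (auto simp: quotient_aut_simps)
  have a: "a \<in> events_tau G" and y': "y' \<in> states G"
    using xy(3) assms(1) by (auto simp: automaton_def)
  have "weak_run G x' (List.map_filter id [a]) y'"
    using weak_run_step[OF xy(3) a y'] .
  moreover have "List.map_filter id [a] \<in> lists (alphabet G)"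
    using a by (auto simp: List.map_filter_def events_tau_def)
  \<comment> \<open>The equivalence moves runs from the left member of a pair to the right one, so
    the pair is needed in this order.\<close>
  moreover have "(x', x) \<in> R"
    using eq xy(1) by (meson equivE symD)
  ultimately obtain y where y: "weak_run G x (List.map_filter id [a]) y" "(y', y) \<in> R"
    using assms(2) unfolding opaque_observation_equivalence_def by blast
  have "Y = R `` {y'}"
    using eq Y xy(2) by (metis Image_singleton_iff equiv_class_eq quotientE)
  then have "Y = R `` {y}"
    using eq y(2) by (simp add: equiv_class_eq)
  moreover have "y \<in> states G"
    using eq y(2) by (metis equiv_class_eq_iff)
  ultimately show ?thesis
    using y(1) by blast
qed

lemma quotient_takes_part:
  assumes "equiv (states G) R" and "x \<in> states G" and "y \<in> states G" and "takes_part G \<sigma> x y"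
  shows "takes_part (quotient_aut G R) \<sigma> (R `` {x}) (R `` {y})"
  using assms equiv_class_self[OF assms(1)]
  by (auto simp: takes_part_def quotient_aut_simps quotientI split: if_splits)

section \<open>The projection to classes as a weak bisimulation\<close>

text \<open>This is the graph of the canonical projection applied to the first component, restricted
  to genuine states of the composition.\<close>

definition quotient_relation ::
  "('p, 'e) aut \<Rightarrow> ('q, 'e) aut list \<Rightarrow> ('p \<times> 'p) set \<Rightarrow>
     (('p \<times> 'q list) \<times> ('p set \<times> 'q list)) set" where
  "quotient_relation G Gs R =
     {((x, xs), (R `` {x}, xs)) | x xs. (x, xs) \<in> states (sync_or G Gs)}"

lemma quotient_relation_states:
  "quotient_relation G Gs R \<subseteq> states (sync_or G Gs) \<times> states (sync_or (quotient_aut G R) Gs)"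
  by (auto simp: quotient_relation_def sync_or_simps tuples_def quotient_aut_simps quotientI)

text \<open>In this direction each step is answered by a single step with the same event, because
  projecting to classes preserves transitions.\<close>

lemma weak_simulation_quotient:
  assumes eq: "equiv (states G) R"
  shows "weak_simulation (sync_or G Gs) (sync_or (quotient_aut G R) Gs) (quotient_relation G Gs R)"
  unfolding weak_simulation_def
proof (intro conjI allI impI quotient_relation_states, elim conjE)
  fix p q a p'
  assume pq: "(p, q) \<in> quotient_relation G Gs R"
    and step: "(p, a, p') \<in> transitions (sync_or G Gs)"
  obtain x xs y ys where p: "p = (x, xs)" "q = (R `` {x}, xs)" "p' = (y, ys)"
    using pq by (cases p') (auto simp: quotient_relation_def)
  have st: "(x, xs) \<in> states (sync_or G Gs)" "(y, ys) \<in> states (sync_or G Gs)"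
    using step sync_or_transition_closed(2)[OF step] pq p by (auto simp: quotient_relation_def)
  then have xy: "x \<in> states G" "y \<in> states G"
    by (auto simp: sync_or_simps tuples_def)
  have rel: "(p', (R `` {y}, ys)) \<in> quotient_relation G Gs R"
    using st p by (auto simp: quotient_relation_def)
  have stq: "(R `` {x}, xs) \<in> states (sync_or (quotient_aut G R) Gs)"
      "(R `` {y}, ys) \<in> states (sync_or (quotient_aut G R) Gs)"
    using quotient_relation_states[of G Gs R] pq rel p by blast+
  have "(q, a, (R `` {y}, ys)) \<in> transitions (sync_or (quotient_aut G R) Gs)"
  proof (cases a)
    case None
    have "(R `` {x}, None, R `` {y}) \<in> transitions (quotient_aut G R)"
      if "(x, None, y) \<in> transitions G"
      using that xy equiv_class_self[OF eq] by (auto simp: quotient_aut_simps quotientI)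
    then show ?thesis
      using step None stq unfolding p None sync_or_transition_None by blast
  next
    case (Some \<sigma>)
    then show ?thesis
      using step stq quotient_takes_part[OF eq xy]
      unfolding p Some sync_or_transition_Some by (simp add: sync_or_simps quotient_aut_simps)
  qed
  then show "\<exists>q'. weak_run (sync_or (quotient_aut G R) Gs) q (List.map_filter id [a]) q' \<and>
      (p', q') \<in> quotient_relation G Gs R"
    using weak_run_sync_or_step rel by blast
qed

text \<open>Here a step of the quotient may cost extra silent steps. The cases are sorted by whether
  the first component moves (\<open>lift\<close>) or stays put (\<open>stay\<close>).\<close>

lemma weak_simulation_quotient_converse:
  assumes aut: "automaton G" and oe: "opaque_observation_equivalence G R"
  shows "weak_simulation (sync_or (quotient_aut G R) Gs) (sync_or G Gs) ((quotient_relation G Gs R)\<inverse>)"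
  unfolding weak_simulation_def
proof (intro conjI allI impI, goal_cases)
  case 1
  then show ?case
    using quotient_relation_states[of G Gs R] by blast
next
  case (2 q p a q')
  then have pq: "(p, q) \<in> quotient_relation G Gs R"
    and step: "(q, a, q') \<in> transitions (sync_or (quotient_aut G R) Gs)"
    by auto
  have tr: "transitions G \<subseteq> states G \<times> events_tau G \<times> states G"
    using aut by (simp add: automaton_def)
  obtain x xs Y ys where p: "p = (x, xs)" "q = (R `` {x}, xs)" "q' = (Y, ys)"
    using pq by (cases q') (auto simp: quotient_relation_def)
  have st: "(x, xs) \<in> states (sync_or G Gs)"
    using pq p by (auto simp: quotient_relation_def)
  then have x: "x \<in> states G" and xs: "list_all2 (\<lambda>y G. y \<in> states G) xs Gs"
    by (auto simp: sync_or_simps tuples_def)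
  have ys: "list_all2 (\<lambda>y G. y \<in> states G) ys Gs"
    using sync_or_transition_closed(2)[OF step] p by (auto simp: sync_or_simps tuples_def)
  \<comment> \<open>The silent steps of the answer in \<open>G\<close> are unknown, so
    \<open>runs\<close> asks that every run with the right observable word lift to the composition
    with the others going from \<open>xs\<close> to \<open>ys\<close>.\<close>
  have lift: "\<exists>y. weak_run (sync_or G Gs) (x, xs) (List.map_filter id [a]) (y, ys) \<and>
      Y = R `` {y} \<and> y \<in> states G"
    if quot: "(R `` {x}, a, Y) \<in> transitions (quotient_aut G R)"
      and runs: "\<And>t y. run G x t y \<Longrightarrow> List.map_filter id t = List.map_filter id [a] \<Longrightarrow>
        run (sync_or G Gs) (x, xs) t (y, ys)"
  proof -
    obtain y where y: "Y = R `` {y}" "y \<in> states G" "weak_run G x (List.map_filter id [a]) y"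
      using quotient_transition_weak_run[OF aut oe quot] by blast
    \<comment> \<open>A weak run must use events of its own automaton, so the lifted run has to be
      checked against the larger alphabet.\<close>
    have "events_tau G \<subseteq> events_tau (sync_or G Gs)" "alphabet G \<subseteq> alphabet (sync_or G Gs)"
      by (auto simp: events_tau_def sync_or_simps)
    then have "weak_run (sync_or G Gs) (x, xs) (List.map_filter id [a]) (y, ys)"
      using y(3) runs unfolding weak_run_def by (meson lists_mono subsetD)
    then show ?thesis
      using y by blast
  qed
  \<comment> \<open>The class is unchanged, so \<open>x\<close> itself serves as the new
    representative.\<close>
  have stay: "\<exists>y. weak_run (sync_or G Gs) (x, xs) (List.map_filter id [a]) (y, ys) \<and>
      Y = R `` {y} \<and> y \<in> states G"
    if "Y = R `` {x}" and "((x, xs), a, (x, ys)) \<in> transitions (sync_or G Gs)"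
    using that x weak_run_sync_or_step by blast
  have stx: "(x, ys) \<in> states (sync_or G Gs)"
    using x ys by (simp add: sync_or_simps tuples_def)
  have "\<exists>y. weak_run (sync_or G Gs) (x, xs) (List.map_filter id [a]) (y, ys) \<and>
      Y = R `` {y} \<and> y \<in> states G"
  proof (cases a)
    case None
    consider (first) "(R `` {x}, None, Y) \<in> transitions (quotient_aut G R)" "ys = xs"
      | (other) i z where "Y = R `` {x}" "ys = xs[i := z]" "i < length Gs"
          "(xs ! i, None, z) \<in> transitions (Gs ! i)"
      using step unfolding p None sync_or_transition_None by blast
    then show ?thesis
    proof cases
      case first
      show ?thesis
      proof (rule lift)
        show "(R `` {x}, a, Y) \<in> transitions (quotient_aut G R)"
          using first None by simp
        show "run (sync_or G Gs) (x, xs) t (y, ys)"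
          if "run G x t y" "List.map_filter id t = List.map_filter id [a]" for t y
          using run_sync_or_silent[OF tr that(1) _ st] that(2) None first(2)
          by (simp add: List.map_filter_def)
      qed
    next
      case other
      then have "((x, xs), a, (x, ys)) \<in> transitions (sync_or G Gs)"
        using st stx unfolding None sync_or_transition_None by blast
      then show ?thesis
        using stay other by blast
    qed
  next
    case (Some \<sigma>)
    have part: "takes_part (quotient_aut G R) \<sigma> (R `` {x}) Y"
        "\<forall>i < length Gs. takes_part (Gs ! i) \<sigma> (xs ! i) (ys ! i)"
      and \<sigma>: "\<sigma> \<in> alphabet (sync_or G Gs)"
      using step unfolding p Some sync_or_transition_Some
      by (auto simp: sync_or_simps quotient_aut_simps)
    show ?thesis
    proof (cases "\<sigma> \<in> alphabet G")
      case True
      show ?thesis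
      proof (rule lift)
        show "(R `` {x}, a, Y) \<in> transitions (quotient_aut G R)"
          using part(1) True Some by (simp add: takes_part_def quotient_aut_simps(1))
        show "run (sync_or G Gs) (x, xs) t (y, ys)"
          if "run G x t y" "List.map_filter id t = List.map_filter id [a]" for t y
          using run_sync_or_observable[OF tr True xs ys part(2) that(1)] that(2) Some
          by (simp add: List.map_filter_def)
      qed
    next
      \<comment> \<open>The event belongs only to other components, so the first one keeps its class
        and the step is copied with \<open>x\<close> fixed.\<close>
      case False
      then have "Y = R `` {x}"
        using part(1) by (simp add: takes_part_def quotient_aut_simps(1))
      moreover have "((x, xs), a, (x, ys)) \<in> transitions (sync_or G Gs)"
        using False st stx part(2) \<sigma> unfolding Some sync_or_transition_Some
        by (simp add: takes_part_def)
      ultimately show ?thesis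
        using stay by blast
    qed
  qed
  then obtain y where y: "weak_run (sync_or G Gs) (x, xs) (List.map_filter id [a]) (y, ys)"
      "Y = R `` {y}" "y \<in> states G"
    by blast
  then have "((y, ys), q') \<in> quotient_relation G Gs R"
    using ys p by (auto simp: quotient_relation_def sync_or_simps tuples_def)
  then show ?case
    using y(1) p by blast
qed

section \<open>Secret classes and the final equivalence\<close>

text \<open>A class counts as secret as soon as one representative is secret; related states agree
  on secrecy, so the choice of representative is immaterial.\<close>

lemma nonsecret_quotient:
  assumes "opaque_observation_equivalence G R" and "x \<in> states G"
  shows "R `` {x} \<in> nonsecret (quotient_aut G R) \<longleftrightarrow> x \<in> nonsecret G"
proof -
  have eq: "equiv (states G) R"
    using assms(1) by (simp add: opaque_observation_equivalence_def)
  have "R `` {x} \<in> secret (quotient_aut G R) \<longleftrightarrow> x \<in> secret G"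
  proof
    assume "R `` {x} \<in> secret (quotient_aut G R)"
    then obtain y where y: "R `` {x} = R `` {y}" "y \<in> secret G"
      by (auto simp: quotient_aut_simps)
    then have "(y, x) \<in> R"
      using equiv_class_self[OF eq assms(2)] by auto
    then show "x \<in> secret G"
      using assms(1) y(2) unfolding opaque_observation_equivalence_def by blast
  qed (auto simp: quotient_aut_simps)
  then show ?thesis
    using assms(2) by (simp add: nonsecret_def quotient_aut_simps(2) quotientI)
qed

theorem theorem4:
  fixes G1 :: "('p, 'e) aut"
    and Gs :: "('q, 'e) aut list"
    and R :: "('p \<times> 'p) set"
  assumes "automaton G1"
    and "\<forall>G \<in> set Gs. automaton G"
    and "opaque_observation_equivalence G1 R"
  shows "infinite_step_opaque (sync_or G1 Gs) \<longleftrightarrow>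
         infinite_step_opaque (sync_or (quotient_aut G1 R) Gs)"
proof -
  let ?A = "sync_or G1 Gs" and ?B = "sync_or (quotient_aut G1 R) Gs"
  let ?S = "quotient_relation G1 Gs R"
  have eq: "equiv (states G1) R"
    using assms(3) by (simp add: opaque_observation_equivalence_def)
  have alph: "alphabet ?A = alphabet ?B"
    by (simp add: sync_or_simps quotient_aut_simps)
  have AB: "weak_simulation ?A ?B ?S" and BA: "weak_simulation ?B ?A (?S\<inverse>)"
    using weak_simulation_quotient[OF eq] weak_simulation_quotient_converse[OF assms(1,3)] by auto
  \<comment> \<open>Related tuples share all components but the first, so secrecy is compared
    through \<open>nonsecret_quotient\<close> alone.\<close>
  have sec: "p \<in> secret ?A \<longleftrightarrow> q \<in> secret ?B" if "(p, q) \<in> ?S" for p q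
    using that nonsecret_quotient[OF assms(3)]
    by (auto simp: quotient_relation_def sync_or_simps tuples_def quotient_aut_simps(2) quotientI)
  \<comment> \<open>\<open>quotient_relation\<close> relates only states, so initial tuples must be
    known to be states before they can be matched.\<close>
  have initial: "initial ?A \<subseteq> states ?A"
    using assms(1,2) unfolding sync_or_simps tuples_def automaton_def
    by (auto simp: list_all2_conv_all_nth) (meson nth_mem subsetD)
  have init_AB: "\<exists>q \<in> initial ?B. (p, q) \<in> ?S" if "p \<in> initial ?A" for p
    using that initial
    by (cases p) (auto simp: quotient_relation_def sync_or_simps(1,3,4) tuples_def quotient_aut_simps)
  have init_BA: "\<exists>p \<in> initial ?A. (p, q) \<in> ?S" if q: "q \<in> initial ?B" for q
  proof -
    \<comment> \<open>An initial class may have noninitial members; the representative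
      \<open>x\<close> is chosen initial.\<close>
    obtain x xs where "q = (R `` {x}, xs)" "(x, xs) \<in> initial ?A"
      using q by (cases q) (auto simp: sync_or_simps tuples_def quotient_aut_simps)
    then show ?thesis
      using initial by (auto simp: quotient_relation_def)
  qed
  show ?thesis
  proof
    assume "infinite_step_opaque ?A"
    then show "infinite_step_opaque ?B"
      using infinite_step_opaque_bisimilar[OF alph AB BA sec init_AB init_BA] by blast
  next
    assume B: "infinite_step_opaque ?B"
    show "infinite_step_opaque ?A"
    \<comment> \<open>The same transfer lemma is applied with the two systems exchanged and the
      relation reversed.\<close>
    proof (rule infinite_step_opaque_bisimilar[where S = "?S\<inverse>" and A = ?B])
      show "weak_simulation ?A ?B ((?S\<inverse>)\<inverse>)"
        using AB by simp
    qed (use alph BA sec init_AB init_BA B in auto)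
  qed
qed

end
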